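(* Let $R$ be a commutative ring with unity, $\Gamma$ a commutative monoid of finite type, $M$ an $R$-module, and $L\in\mathcal T(\Gamma,R)$ a totally multiplicative function. Then: (1) The map $\Phi_{L,R}:\mathcal F(\Gamma,R)\to\mathcal F(\Gamma,R)$, $\Phi_{L,R}(\alpha)(n):=L(n)\alpha(n)$, is a morphism of $R$-algebras. (2) $\mathcal F(\Gamma,M)$ has a structure of an $\mathcal F(\Gamma,R)$-module given by $\alpha\cdot_L f:=\Phi_{L,R}(\alpha)\cdot f$. Denote this module by $\mathcal F_L(\Gamma,M)$. (3) The map $\Phi_{L,M}:\mathcal F(\Gamma,M)\to\mathcal F_L(\Gamma,M)$, $\Phi_{L,M}(f)(n):=L(n)f(n)$, is a morphism of $\mathcal F(\Gamma,R)$-modules.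
   Context: A monoid $(\Gamma,\cdot,1)$ is of finite type if for each $n\in\Gamma$ the set $\{(a,b)\in\Gamma\times\Gamma : n=ab\}$ is finite. $\mathcal F(\Gamma,R)$ is the set of all functions $\alpha:\Gamma\to R$, a commutative ring with unity under pointwise addition and $(\alpha\cdot\beta)(n)=\sum_{ab=n}\alpha(a)\beta(b)$; its unity is $e$ with $e(1)=1$ and $e(n)=0$ for $n\ne 1$. It is an $R$-algebra via $i:R\to\mathcal F(\Gamma,R)$, $i(r)(1)=r$, $i(r)(n)=0$ for $n\neq1$. For an $R$-module $M$, $\mathcal F(\Gamma,M)$ is the set of all functions $f:\Gamma\to M$, an $\mathcal F(\Gamma,R)$-module under pointwise addition and $(\alpha\cdot f)(n)=\sum_{ab=n}\alpha(a)f(b)$. A function $L\in\mathcal F(\Gamma,R)$ is totally multiplicative if it is a monoid morphism from $(\Gamma,\cdot)$ to $(R,\cdot)$, i.e. $L(ab)=L(a)L(b)$ for all $a,b\in\Gamma$ and $L(1)=1$; $\mathcal T(\Gamma,R)$ denotes the set of such functions. *)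

theory Defs
  imports "HOL-Algebra.Module" "HOL-Library.FuncSet"
begin

definition factorizations :: "('g, 'x) monoid_scheme \<Rightarrow> 'g \<Rightarrow> ('g \<times> 'g) set" where
  "factorizations G n = {(a, b) \<in> carrier G \<times> carrier G. n = a \<otimes>\<^bsub>G\<^esub> b}"

definition finite_type :: "('g, 'x) monoid_scheme \<Rightarrow> bool" where
  "finite_type G \<longleftrightarrow> (\<forall>n \<in> carrier G. finite (factorizations G n))"

text \<open>The functions from \<open>\<Gamma>\<close> to \<open>R\<close> (or \<open>M\<close>) are the extensional functions on the carrier,
  so that equality in \<open>\<F>(\<Gamma>,R)\<close> and \<open>\<F>(\<Gamma>,M)\<close> is pointwise equality on \<open>carrier \<Gamma>\<close>.\<close>

definition arith_conv ::
  "('g, 'x) monoid_scheme \<Rightarrow> ('r, 'y) ring_scheme \<Rightarrow> ('g \<Rightarrow> 'r) \<Rightarrow> ('g \<Rightarrow> 'r) \<Rightarrow> 'g \<Rightarrow> 'r" where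
  "arith_conv G R \<alpha> \<beta> =
     (\<lambda>n \<in> carrier G. finsum R (\<lambda>(a, b). \<alpha> a \<otimes>\<^bsub>R\<^esub> \<beta> b) (factorizations G n))"

text \<open>The structure map \<open>i : R \<rightarrow> \<F>(\<Gamma>,R)\<close>.\<close>

definition arith_const ::
  "('g, 'x) monoid_scheme \<Rightarrow> ('r, 'y) ring_scheme \<Rightarrow> 'r \<Rightarrow> 'g \<Rightarrow> 'r" where
  "arith_const G R r = (\<lambda>n \<in> carrier G. if n = \<one>\<^bsub>G\<^esub> then r else \<zero>\<^bsub>R\<^esub>)"

text \<open>\<open>\<F>(\<Gamma>,R)\<close> as a ring, together with the \<open>R\<close>-algebra structure induced by \<open>i\<close>:
  \<open>r \<odot> \<alpha> = i(r) \<cdot> \<alpha>\<close>.\<close>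

definition arith_ring ::
  "('g, 'x) monoid_scheme \<Rightarrow> ('r, 'y) ring_scheme \<Rightarrow> ('r, 'g \<Rightarrow> 'r) module" where
  "arith_ring G R =
    \<lparr>carrier = carrier G \<rightarrow>\<^sub>E carrier R,
     mult = arith_conv G R,
     one = (\<lambda>n \<in> carrier G. if n = \<one>\<^bsub>G\<^esub> then \<one>\<^bsub>R\<^esub> else \<zero>\<^bsub>R\<^esub>),
     zero = (\<lambda>n \<in> carrier G. \<zero>\<^bsub>R\<^esub>),
     add = (\<lambda>\<alpha> \<beta>. \<lambda>n \<in> carrier G. \<alpha> n \<oplus>\<^bsub>R\<^esub> \<beta> n),
     smult = (\<lambda>r \<alpha>. arith_conv G R (arith_const G R r) \<alpha>)\<rparr>"

text \<open>\<open>\<F>(\<Gamma>,M)\<close> as an \<open>\<F>(\<Gamma>,R)\<close>-module. The fields \<open>mult\<close> and \<open>one\<close>, which the record type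
  inherits from rings, play no role in the locale \<open>module\<close> and are left unspecified.\<close>

definition arith_module ::
  "('g, 'x) monoid_scheme \<Rightarrow> ('r, 'm, 'z) module_scheme \<Rightarrow> ('g \<Rightarrow> 'r, 'g \<Rightarrow> 'm) module" where
  "arith_module G M =
    \<lparr>carrier = carrier G \<rightarrow>\<^sub>E carrier M,
     mult = undefined,
     one = undefined,
     zero = (\<lambda>n \<in> carrier G. \<zero>\<^bsub>M\<^esub>),
     add = (\<lambda>f g. \<lambda>n \<in> carrier G. f n \<oplus>\<^bsub>M\<^esub> g n),
     smult = (\<lambda>\<alpha> f. \<lambda>n \<in> carrier G.
       finsum M (\<lambda>(a, b). \<alpha> a \<odot>\<^bsub>M\<^esub> f b) (factorizations G n))\<rparr>"

text \<open>The constant \<open>hom\<close> only asks for compatibility with multiplication; preservation of the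
  unit has to be required separately.\<close>

definition totally_multiplicative ::
  "('g, 'x) monoid_scheme \<Rightarrow> ('r, 'y) ring_scheme \<Rightarrow> ('g \<Rightarrow> 'r) set" where
  "totally_multiplicative G R =
    {L \<in> carrier G \<rightarrow>\<^sub>E carrier R. L \<in> hom G R \<and> L \<one>\<^bsub>G\<^esub> = \<one>\<^bsub>R\<^esub>}"

definition Phi_ring ::
  "('g, 'x) monoid_scheme \<Rightarrow> ('r, 'y) ring_scheme \<Rightarrow> ('g \<Rightarrow> 'r) \<Rightarrow> ('g \<Rightarrow> 'r) \<Rightarrow> 'g \<Rightarrow> 'r" where
  "Phi_ring G R L \<alpha> = (\<lambda>n \<in> carrier G. L n \<otimes>\<^bsub>R\<^esub> \<alpha> n)"

definition Phi_module ::
  "('g, 'x) monoid_scheme \<Rightarrow> ('r, 'm, 'z) module_scheme \<Rightarrow> ('g \<Rightarrow> 'r) \<Rightarrow> ('g \<Rightarrow> 'm) \<Rightarrow> 'g \<Rightarrow> 'm" where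
  "Phi_module G M L f = (\<lambda>n \<in> carrier G. L n \<odot>\<^bsub>M\<^esub> f n)"

text \<open>\<open>\<F>\<^sub>L(\<Gamma>,M)\<close>: the additive group of \<open>\<F>(\<Gamma>,M)\<close> with the twisted scalar multiplication
  \<open>\<alpha> \<cdot>\<^sub>L f = \<Phi>(\<alpha>) \<cdot> f\<close>.\<close>

definition twisted_arith_module ::
  "('g, 'x) monoid_scheme \<Rightarrow> ('r, 'y) ring_scheme \<Rightarrow> ('r, 'm, 'z) module_scheme \<Rightarrow>
   ('g \<Rightarrow> 'r) \<Rightarrow> ('g \<Rightarrow> 'r, 'g \<Rightarrow> 'm) module" where
  "twisted_arith_module G R M L =
    (arith_module G M)
      \<lparr>smult := (\<lambda>\<alpha> f. Phi_ring G R L \<alpha> \<odot>\<^bsub>arith_module G M\<^esub> f)\<rparr>"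

definition algebra_morphism ::
  "('r, 'y) ring_scheme \<Rightarrow> ('r, 'a, 'u) module_scheme \<Rightarrow> ('r, 'b, 'v) module_scheme \<Rightarrow>
   ('a \<Rightarrow> 'b) \<Rightarrow> bool" where
  "algebra_morphism R A B h \<longleftrightarrow>
     algebra R A \<and> algebra R B \<and> h \<in> ring_hom A B \<and>
     (\<forall>r \<in> carrier R. \<forall>x \<in> carrier A. h (r \<odot>\<^bsub>A\<^esub> x) = r \<odot>\<^bsub>B\<^esub> h x)"

definition module_morphism ::
  "('r, 'y) ring_scheme \<Rightarrow> ('r, 'a, 'u) module_scheme \<Rightarrow> ('r, 'b, 'v) module_scheme \<Rightarrow>
   ('a \<Rightarrow> 'b) \<Rightarrow> bool" where
  "module_morphism R M N h \<longleftrightarrow>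
     module R M \<and> module R N \<and> h \<in> carrier M \<rightarrow> carrier N \<and>
     (\<forall>x \<in> carrier M. \<forall>y \<in> carrier M. h (x \<oplus>\<^bsub>M\<^esub> y) = h x \<oplus>\<^bsub>N\<^esub> h y) \<and>
     (\<forall>r \<in> carrier R. \<forall>x \<in> carrier M. h (r \<odot>\<^bsub>M\<^esub> x) = r \<odot>\<^bsub>N\<^esub> h x)"

end

theory Submission
  imports Defs
begin

text \<open>
  Everything rests on three facts about the convolution action of \<open>\<F>(\<Gamma>,R)\<close> on \<open>\<F>(\<Gamma>,M)\<close>.
  It is associative, because both \<open>((\<alpha> \<cdot> \<beta>) \<cdot> f)(n)\<close> and \<open>(\<alpha> \<cdot> (\<beta> \<cdot> f))(n)\<close> are the sum of
  \<open>\<alpha>(a) \<beta>(b) f(d)\<close> over all triples with \<open>abd = n\<close> (\<open>arith_smult_assoc\<close>); constants act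
  pointwise, \<open>i(r) \<cdot> f = r f\<close> (\<open>arith_const_smult\<close>); and multiplication by a totally
  multiplicative \<open>L\<close> distributes over it, \<open>L(\<alpha> \<cdot> f) = (L\<alpha>) \<cdot> (L f)\<close>, since \<open>L(n) = L(a) L(b)\<close>
  for every factorization \<open>n = ab\<close> (\<open>Phi_module_smult\<close>).

  The convolution ring is the case \<open>M = R\<close> of the action (\<open>arith_conv_eq_smult\<close>). Together with
  biadditivity, and with commutativity, which comes from exchanging the factors of each
  factorization, these facts make \<open>\<F>(\<Gamma>,R)\<close> a commutative \<open>R\<close>-algebra, \<open>\<F>(\<Gamma>,M)\<close> a module over
  it, and \<open>\<Phi>\<close> a morphism of algebras. The twisted module is then the restriction of scalars of \<open>\<F>(\<Gamma>,M)\<close> along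
  the ring endomorphism \<open>\<Phi>\<close>, and the third fact is precisely the linearity of
  \<open>\<F>(\<Gamma>,M) \<rightarrow> \<F>\<^sub>L(\<Gamma>,M)\<close>.
\<close>

section \<open>Finite sums and modules\<close>

lemma (in comm_monoid) finprod_Sigma:
  assumes "finite I" "\<And>i. i \<in> I \<Longrightarrow> finite (A i)"
    and "\<And>i j. i \<in> I \<Longrightarrow> j \<in> A i \<Longrightarrow> f (i, j) \<in> carrier G"
  shows "finprod G f (Sigma I A) = finprod G (\<lambda>i. finprod G (\<lambda>j. f (i, j)) (A i)) I"
proof -
  have "finprod G f (Sigma I A) = finprod G f (\<Union>i\<in>I. Pair i ` A i)"
    by (rule arg_cong[where f = "finprod G f"]) auto
  also have "\<dots> = finprod G (\<lambda>i. finprod G f (Pair i ` A i)) I"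
    using assms by (intro finprod_UN_disjoint) (auto simp: pairwise_def disjnt_def)
  also have "\<dots> = finprod G (\<lambda>i. finprod G (\<lambda>j. f (i, j)) (A i)) I"
    using assms by (intro finprod_cong' finprod_reindex) (auto intro!: inj_onI finprod_closed)
  finally show ?thesis .
qed

lemma (in module) finsum_smult_rdistr:
  assumes "finite A" "x \<in> carrier M" "f \<in> A \<rightarrow> carrier R"
  shows "(\<Oplus>\<^bsub>R\<^esub>i\<in>A. f i) \<odot>\<^bsub>M\<^esub> x = (\<Oplus>\<^bsub>M\<^esub>i\<in>A. f i \<odot>\<^bsub>M\<^esub> x)"
  using assms by (induct set: finite) (simp_all add: Pi_def smult_l_distr)

lemma restriction_of_scalars:
  assumes "cring R" and "module S N" and h: "h \<in> ring_hom R S"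
  shows "module R (N\<lparr>smult := \<lambda>r x. h r \<odot>\<^bsub>N\<^esub> x\<rparr>)"
proof -
  interpret N: module S N by fact
  have "abelian_group (N\<lparr>smult := \<lambda>r x. h r \<odot>\<^bsub>N\<^esub> x\<rparr>)"
    using N.a_comm_monoid N.a_comm_group
    by (simp add: abelian_group_def abelian_monoid_def abelian_group_axioms_def)
  then show ?thesis
    using \<open>cring R\<close> h
    by (intro moduleI)
      (simp_all add: ring_hom_closed[OF h] ring_hom_add[OF h] ring_hom_mult[OF h]
        ring_hom_one[OF h] N.smult_l_distr N.smult_r_distr N.smult_assoc1)
qed

text \<open>A commutative ring as a module over itself.\<close>

definition regular_module :: "('r, 'y) ring_scheme \<Rightarrow> ('r, 'r) module" where
  "regular_module R =
    \<lparr>carrier = carrier R, mult = mult R, one = one R, zero = zero R, add = add R,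
     smult = mult R\<rparr>"

lemma regular_module_simps [simp]:
  "carrier (regular_module R) = carrier R"
  "zero (regular_module R) = zero R"
  "add (regular_module R) = add R"
  "smult (regular_module R) = mult R"
  "finsum (regular_module R) = finsum R"
  by (simp_all add: regular_module_def finsum_def finprod_def fun_eq_iff)

lemma (in cring) module_regular_module: "module R (regular_module R)"
proof (rule moduleI)
  show "abelian_group (regular_module R)"
    by (rule abelian_groupI) (auto simp: a_ac intro: l_neg)
qed (auto simp: l_distr r_distr m_assoc intro: is_cring)

text \<open>Extensional functions into an abelian group form an abelian group pointwise. The record \<open>N\<close>
  is only constrained in its additive part, so that the lemma applies both to the convolution ring
  and to its modules.\<close>

lemma abelian_group_PiE:
  assumes "abelian_group M"
    and [simp]: "carrier N = C \<rightarrow>\<^sub>E carrier M" "zero N = (\<lambda>n\<in>C. \<zero>\<^bsub>M\<^esub>)"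
      "add N = (\<lambda>f g. \<lambda>n\<in>C. f n \<oplus>\<^bsub>M\<^esub> g n)"
  shows "abelian_group N"
proof -
  interpret M: abelian_group M by fact
  show ?thesis
  proof (rule abelian_groupI)
    fix f assume f: "f \<in> carrier N"
    have "(\<lambda>n\<in>C. \<ominus>\<^bsub>M\<^esub> f n) \<in> carrier N"
      using f by (auto simp: PiE_iff)
    moreover have "(\<lambda>n\<in>C. \<ominus>\<^bsub>M\<^esub> f n) \<oplus>\<^bsub>N\<^esub> f = \<zero>\<^bsub>N\<^esub>"
      using f by (auto simp: PiE_iff M.l_neg intro!: restrict_ext)
    ultimately show "\<exists>g\<in>carrier N. g \<oplus>\<^bsub>N\<^esub> f = \<zero>\<^bsub>N\<^esub>" by blast
  next
    fix f assume "f \<in> carrier N"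
    then show "\<zero>\<^bsub>N\<^esub> \<oplus>\<^bsub>N\<^esub> f = f"
      by (intro extensionalityI[of _ C]) (auto simp: PiE_iff)
  qed (auto simp: PiE_iff M.a_ac intro!: restrict_ext)
qed

section \<open>The convolution action\<close>

lemma factorizations_iff:
  "p \<in> factorizations G n \<longleftrightarrow>
    fst p \<in> carrier G \<and> snd p \<in> carrier G \<and> n = fst p \<otimes>\<^bsub>G\<^esub> snd p"
  by (auto simp: factorizations_def)

lemma arith_module_simps [simp]:
  "carrier (arith_module G M) = carrier G \<rightarrow>\<^sub>E carrier M"
  "zero (arith_module G M) = (\<lambda>n\<in>carrier G. \<zero>\<^bsub>M\<^esub>)"
  "add (arith_module G M) = (\<lambda>f g. \<lambda>n\<in>carrier G. f n \<oplus>\<^bsub>M\<^esub> g n)"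
  by (simp_all add: arith_module_def)

lemma arith_ring_simps [simp]:
  "carrier (arith_ring G R) = carrier G \<rightarrow>\<^sub>E carrier R"
  "zero (arith_ring G R) = (\<lambda>n\<in>carrier G. \<zero>\<^bsub>R\<^esub>)"
  "add (arith_ring G R) = (\<lambda>f g. \<lambda>n\<in>carrier G. f n \<oplus>\<^bsub>R\<^esub> g n)"
  "mult (arith_ring G R) = arith_conv G R"
  "one (arith_ring G R) = arith_const G R \<one>\<^bsub>R\<^esub>"
  "smult (arith_ring G R) = (\<lambda>r. arith_conv G R (arith_const G R r))"
  by (simp_all add: arith_ring_def arith_const_def)

lemma arith_smult_apply:
  "n \<in> carrier G \<Longrightarrow> (\<alpha> \<odot>\<^bsub>arith_module G M\<^esub> f) n =
    (\<Oplus>\<^bsub>M\<^esub>p\<in>factorizations G n. \<alpha> (fst p) \<odot>\<^bsub>M\<^esub> f (snd p))"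
  by (simp add: arith_module_def case_prod_beta')

lemma arith_smult_extensional: "\<alpha> \<odot>\<^bsub>arith_module G M\<^esub> f \<in> extensional (carrier G)"
  by (simp add: arith_module_def)

lemma arith_conv_eq_smult: "arith_conv G R = smult (arith_module G (regular_module R))"
  by (simp add: arith_module_def arith_conv_def fun_eq_iff)

text \<open>An \<open>R\<close>-module \<open>M\<close> together with a commutative monoid \<open>G\<close> of finite type. The ring
  \<open>\<F>(G,R)\<close> is covered by taking the regular module for \<open>M\<close>.\<close>

locale arith = module R M + Gamma: comm_monoid G
  for R :: "('r, 'y) ring_scheme" and M :: "('r, 'm, 'z) module_scheme"
    and G :: "('g, 'x) monoid_scheme" +
  assumes finite_type: "finite_type G"
begin

lemma arith_regular: "arith R (regular_module R) G"
  using module_regular_module Gamma.comm_monoid_axioms finite_type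
  by (simp add: arith_def arith_axioms_def)

lemma finite_factorizations: "n \<in> carrier G \<Longrightarrow> finite (factorizations G n)"
  using finite_type by (simp add: finite_type_def)

lemma arith_smult_closed:
  assumes "\<alpha> \<in> carrier G \<rightarrow>\<^sub>E carrier R" "f \<in> carrier G \<rightarrow>\<^sub>E carrier M"
  shows "\<alpha> \<odot>\<^bsub>arith_module G M\<^esub> f \<in> carrier G \<rightarrow>\<^sub>E carrier M"
  using assms arith_smult_extensional[of G M \<alpha> f]
  by (auto simp: PiE_iff arith_smult_apply factorizations_iff intro!: M.finsum_closed)

lemma arith_smult_l_distr:
  assumes "\<alpha> \<in> carrier G \<rightarrow>\<^sub>E carrier R" "\<beta> \<in> carrier G \<rightarrow>\<^sub>E carrier R"
    "f \<in> carrier G \<rightarrow>\<^sub>E carrier M"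
  shows "(\<lambda>n\<in>carrier G. \<alpha> n \<oplus>\<^bsub>R\<^esub> \<beta> n) \<odot>\<^bsub>arith_module G M\<^esub> f =
    (\<lambda>n\<in>carrier G. (\<alpha> \<odot>\<^bsub>arith_module G M\<^esub> f) n \<oplus>\<^bsub>M\<^esub> (\<beta> \<odot>\<^bsub>arith_module G M\<^esub> f) n)"
proof (rule extensionalityI[OF arith_smult_extensional restrict_extensional])
  fix n assume n: "n \<in> carrier G"
  have "(\<Oplus>\<^bsub>M\<^esub>p\<in>factorizations G n. (\<lambda>n\<in>carrier G. \<alpha> n \<oplus>\<^bsub>R\<^esub> \<beta> n) (fst p) \<odot>\<^bsub>M\<^esub> f (snd p)) =
    (\<Oplus>\<^bsub>M\<^esub>p\<in>factorizations G n.
      \<alpha> (fst p) \<odot>\<^bsub>M\<^esub> f (snd p) \<oplus>\<^bsub>M\<^esub> \<beta> (fst p) \<odot>\<^bsub>M\<^esub> f (snd p))"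
    using assms
    by (intro M.finsum_cong') (auto simp: factorizations_iff PiE_iff smult_l_distr)
  also have "\<dots> = (\<Oplus>\<^bsub>M\<^esub>p\<in>factorizations G n. \<alpha> (fst p) \<odot>\<^bsub>M\<^esub> f (snd p)) \<oplus>\<^bsub>M\<^esub>
    (\<Oplus>\<^bsub>M\<^esub>p\<in>factorizations G n. \<beta> (fst p) \<odot>\<^bsub>M\<^esub> f (snd p))"
    using assms by (intro M.finsum_addf) (auto simp: factorizations_iff PiE_iff)
  finally show "((\<lambda>n\<in>carrier G. \<alpha> n \<oplus>\<^bsub>R\<^esub> \<beta> n) \<odot>\<^bsub>arith_module G M\<^esub> f) n =
    (\<lambda>n\<in>carrier G. (\<alpha> \<odot>\<^bsub>arith_module G M\<^esub> f) n \<oplus>\<^bsub>M\<^esub> (\<beta> \<odot>\<^bsub>arith_module G M\<^esub> f) n) n"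
    using n by (simp add: arith_smult_apply)
qed

lemma arith_smult_r_distr:
  assumes "\<alpha> \<in> carrier G \<rightarrow>\<^sub>E carrier R" "f \<in> carrier G \<rightarrow>\<^sub>E carrier M"
    "g \<in> carrier G \<rightarrow>\<^sub>E carrier M"
  shows "\<alpha> \<odot>\<^bsub>arith_module G M\<^esub> (\<lambda>n\<in>carrier G. f n \<oplus>\<^bsub>M\<^esub> g n) =
    (\<lambda>n\<in>carrier G. (\<alpha> \<odot>\<^bsub>arith_module G M\<^esub> f) n \<oplus>\<^bsub>M\<^esub> (\<alpha> \<odot>\<^bsub>arith_module G M\<^esub> g) n)"
proof (rule extensionalityI[OF arith_smult_extensional restrict_extensional])
  fix n assume n: "n \<in> carrier G"
  have "(\<Oplus>\<^bsub>M\<^esub>p\<in>factorizations G n. \<alpha> (fst p) \<odot>\<^bsub>M\<^esub> (\<lambda>n\<in>carrier G. f n \<oplus>\<^bsub>M\<^esub> g n) (snd p)) =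
    (\<Oplus>\<^bsub>M\<^esub>p\<in>factorizations G n.
      \<alpha> (fst p) \<odot>\<^bsub>M\<^esub> f (snd p) \<oplus>\<^bsub>M\<^esub> \<alpha> (fst p) \<odot>\<^bsub>M\<^esub> g (snd p))"
    using assms
    by (intro M.finsum_cong') (auto simp: factorizations_iff PiE_iff smult_r_distr)
  also have "\<dots> = (\<Oplus>\<^bsub>M\<^esub>p\<in>factorizations G n. \<alpha> (fst p) \<odot>\<^bsub>M\<^esub> f (snd p)) \<oplus>\<^bsub>M\<^esub>
    (\<Oplus>\<^bsub>M\<^esub>p\<in>factorizations G n. \<alpha> (fst p) \<odot>\<^bsub>M\<^esub> g (snd p))"
    using assms by (intro M.finsum_addf) (auto simp: factorizations_iff PiE_iff)
  finally show "(\<alpha> \<odot>\<^bsub>arith_module G M\<^esub> (\<lambda>n\<in>carrier G. f n \<oplus>\<^bsub>M\<^esub> g n)) n =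
    (\<lambda>n\<in>carrier G. (\<alpha> \<odot>\<^bsub>arith_module G M\<^esub> f) n \<oplus>\<^bsub>M\<^esub> (\<alpha> \<odot>\<^bsub>arith_module G M\<^esub> g) n) n"
    using n by (simp add: arith_smult_apply)
qed

lemma arith_smult_assoc:
  assumes \<alpha>: "\<alpha> \<in> carrier G \<rightarrow>\<^sub>E carrier R" and \<beta>: "\<beta> \<in> carrier G \<rightarrow>\<^sub>E carrier R"
    and f: "f \<in> carrier G \<rightarrow>\<^sub>E carrier M"
  shows "arith_conv G R \<alpha> \<beta> \<odot>\<^bsub>arith_module G M\<^esub> f =
    \<alpha> \<odot>\<^bsub>arith_module G M\<^esub> (\<beta> \<odot>\<^bsub>arith_module G M\<^esub> f)"
proof (rule extensionalityI[OF arith_smult_extensional arith_smult_extensional])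
  fix n assume n: "n \<in> carrier G"
  let ?F = "factorizations G"
  \<comment> \<open>Triples \<open>(a, b, d)\<close> with \<open>abd = n\<close>, bracketed as \<open>(ab)d\<close> and as \<open>a(bd)\<close>:
    the outer factorization comes first, then that of its composite entry.\<close>
  let ?S = "SIGMA p:?F n. ?F (fst p)" and ?T = "SIGMA p:?F n. ?F (snd p)"
  \<comment> \<open>The rebracketing bijection from \<open>?S\<close> to \<open>?T\<close>; it drops \<open>c\<close>, which equals \<open>ab\<close> on \<open>?S\<close>.\<close>
  let ?h = "\<lambda>((c, d), (a, b)). ((a, b \<otimes>\<^bsub>G\<^esub> d), (b, d))"
  let ?t = "\<lambda>q. \<alpha> (fst (fst q)) \<odot>\<^bsub>M\<^esub> (\<beta> (fst (snd q)) \<odot>\<^bsub>M\<^esub> f (snd (snd q)))"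
  let ?s = "\<lambda>q. (\<alpha> (fst (snd q)) \<otimes>\<^bsub>R\<^esub> \<beta> (snd (snd q))) \<odot>\<^bsub>M\<^esub> f (snd (fst q))"
  note [simp] = factorizations_iff
  have fin: "finite (?F m)" if "m \<in> carrier G" for m
    using that by (rule finite_factorizations)
  have \<alpha>c: "\<alpha> a \<in> carrier R" and \<beta>c: "\<beta> a \<in> carrier R" and fc: "f a \<in> carrier M"
    if "a \<in> carrier G" for a using \<alpha> \<beta> f that by (auto simp: PiE_iff)
  note [simp] = \<alpha>c \<beta>c fc
  have "(arith_conv G R \<alpha> \<beta> \<odot>\<^bsub>arith_module G M\<^esub> f) n = (\<Oplus>\<^bsub>M\<^esub>p\<in>?F n.
      (\<Oplus>\<^bsub>R\<^esub>q\<in>?F (fst p). \<alpha> (fst q) \<otimes>\<^bsub>R\<^esub> \<beta> (snd q)) \<odot>\<^bsub>M\<^esub> f (snd p))"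
    unfolding arith_smult_apply[OF n]
    by (intro M.finsum_cong')
      (auto simp: arith_conv_def case_prod_beta' intro!: R.finsum_closed smult_closed)
  also have "\<dots> = (\<Oplus>\<^bsub>M\<^esub>p\<in>?F n. \<Oplus>\<^bsub>M\<^esub>q\<in>?F (fst p). ?s (p, q))"
    by (intro M.finsum_cong')
      (auto simp: fin finsum_smult_rdistr intro!: M.finsum_closed)
  also have "\<dots> = (\<Oplus>\<^bsub>M\<^esub>q\<in>?S. ?s q)"
    using n fin by (intro M.add.finprod_Sigma[symmetric]) auto
  also have "\<dots> = (\<Oplus>\<^bsub>M\<^esub>q\<in>?S. ?t (?h q))"
    by (intro M.finsum_cong') (auto simp: smult_assoc1)
  also have "\<dots> = (\<Oplus>\<^bsub>M\<^esub>q\<in>?h ` ?S. ?t q)"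
  proof (rule M.finsum_reindex[symmetric])
    show "?t \<in> ?h ` ?S \<rightarrow> carrier M"
      by (auto intro!: smult_closed)
    show "inj_on ?h ?S"
    proof (rule inj_onI)
      fix q r assume S: "q \<in> ?S" "r \<in> ?S" and h: "?h q = ?h r"
      have "fst (fst q) = fst (snd q) \<otimes>\<^bsub>G\<^esub> snd (snd q)"
        "fst (fst r) = fst (snd r) \<otimes>\<^bsub>G\<^esub> snd (snd r)"
        using S by auto
      moreover have "snd q = snd r" "snd (fst q) = snd (fst r)"
        using h by (simp_all add: case_prod_beta prod_eq_iff)
      ultimately show "q = r"
        by (simp add: prod_eq_iff)
    qed
  qed
  also have "?h ` ?S = ?T"
  proof
    show "?h ` ?S \<subseteq> ?T"
      by (auto simp: Gamma.m_assoc)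
    show "?T \<subseteq> ?h ` ?S"
    proof
      fix q assume q: "q \<in> ?T"
      obtain a e b d where [simp]: "q = ((a, e), (b, d))" by (metis prod.collapse)
      have "q = ?h ((a \<otimes>\<^bsub>G\<^esub> b, d), (a, b))" "((a \<otimes>\<^bsub>G\<^esub> b, d), (a, b)) \<in> ?S"
        using q by (auto simp: Gamma.m_assoc)
      then show "q \<in> ?h ` ?S" by (rule image_eqI)
    qed
  qed
  also have "(\<Oplus>\<^bsub>M\<^esub>q\<in>?T. ?t q) = (\<Oplus>\<^bsub>M\<^esub>p\<in>?F n. \<Oplus>\<^bsub>M\<^esub>q\<in>?F (snd p). ?t (p, q))"
    using n fin by (intro M.add.finprod_Sigma) auto
  also have "\<dots> = (\<Oplus>\<^bsub>M\<^esub>p\<in>?F n.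
      \<alpha> (fst p) \<odot>\<^bsub>M\<^esub> (\<Oplus>\<^bsub>M\<^esub>q\<in>?F (snd p). \<beta> (fst q) \<odot>\<^bsub>M\<^esub> f (snd q)))"
    by (intro M.finsum_cong')
      (auto simp: fin finsum_smult_ldistr intro!: M.finsum_closed smult_closed)
  also have "\<dots> = (\<alpha> \<odot>\<^bsub>arith_module G M\<^esub> (\<beta> \<odot>\<^bsub>arith_module G M\<^esub> f)) n"
    unfolding arith_smult_apply[OF n]
    by (intro M.finsum_cong')
      (auto simp: arith_smult_apply intro!: M.finsum_closed smult_closed)
  finally show "(arith_conv G R \<alpha> \<beta> \<odot>\<^bsub>arith_module G M\<^esub> f) n =
    (\<alpha> \<odot>\<^bsub>arith_module G M\<^esub> (\<beta> \<odot>\<^bsub>arith_module G M\<^esub> f)) n" .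
qed

lemma arith_const_smult:
  assumes r: "r \<in> carrier R" and f: "f \<in> carrier G \<rightarrow>\<^sub>E carrier M"
  shows "arith_const G R r \<odot>\<^bsub>arith_module G M\<^esub> f = (\<lambda>n\<in>carrier G. r \<odot>\<^bsub>M\<^esub> f n)"
proof (rule extensionalityI[OF arith_smult_extensional restrict_extensional])
  fix n assume n: "n \<in> carrier G"
  let ?g = "\<lambda>p. arith_const G R r (fst p) \<odot>\<^bsub>M\<^esub> f (snd p)"
  have fc: "f a \<in> carrier M" if "a \<in> carrier G" for a using f that by (auto simp: PiE_iff)
  \<comment> \<open>Only the factorization \<open>n = 1 \<cdot> n\<close> contributes.\<close>
  have "(\<Oplus>\<^bsub>M\<^esub>p\<in>{(\<one>\<^bsub>G\<^esub>, n)}. ?g p) = (\<Oplus>\<^bsub>M\<^esub>p\<in>factorizations G n. ?g p)"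
    using n r fc finite_factorizations[OF n]
    by (intro M.add.finprod_mono_neutral_cong_left)
      (auto simp: factorizations_iff arith_const_def)
  moreover have "(\<Oplus>\<^bsub>M\<^esub>p\<in>{(\<one>\<^bsub>G\<^esub>, n)}. ?g p) = r \<odot>\<^bsub>M\<^esub> f n"
    using n r fc by (simp add: arith_const_def)
  ultimately show "(arith_const G R r \<odot>\<^bsub>arith_module G M\<^esub> f) n =
      (\<lambda>n\<in>carrier G. r \<odot>\<^bsub>M\<^esub> f n) n"
    using n by (simp add: arith_smult_apply)
qed

lemma Phi_module_smult:
  assumes L: "L \<in> totally_multiplicative G R"
    and \<alpha>: "\<alpha> \<in> carrier G \<rightarrow>\<^sub>E carrier R" and f: "f \<in> carrier G \<rightarrow>\<^sub>E carrier M"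
  shows "Phi_module G M L (\<alpha> \<odot>\<^bsub>arith_module G M\<^esub> f) =
    Phi_ring G R L \<alpha> \<odot>\<^bsub>arith_module G M\<^esub> Phi_module G M L f"
proof (rule extensionalityI[OF _ arith_smult_extensional])
  show "Phi_module G M L (\<alpha> \<odot>\<^bsub>arith_module G M\<^esub> f) \<in> extensional (carrier G)"
    by (simp add: Phi_module_def)
  fix n assume n: "n \<in> carrier G"
  have c: "L a \<in> carrier R" "\<alpha> a \<in> carrier R" "f a \<in> carrier M" if "a \<in> carrier G" for a
    using L \<alpha> f that by (auto simp: totally_multiplicative_def)
  have Lmult: "L (a \<otimes>\<^bsub>G\<^esub> b) = L a \<otimes>\<^bsub>R\<^esub> L b" if "a \<in> carrier G" "b \<in> carrier G" for a b
    using L that by (auto simp: totally_multiplicative_def hom_def)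
  \<comment> \<open>Commutativity of \<open>R\<close> allows \<open>L(b)\<close> to move past \<open>\<alpha>(a)\<close>.\<close>
  have "(L a \<otimes>\<^bsub>R\<^esub> L b) \<odot>\<^bsub>M\<^esub> (\<alpha> a \<odot>\<^bsub>M\<^esub> f b) = (L a \<otimes>\<^bsub>R\<^esub> \<alpha> a) \<odot>\<^bsub>M\<^esub> (L b \<odot>\<^bsub>M\<^esub> f b)"
    if "a \<in> carrier G" "b \<in> carrier G" for a b
    using that by (simp add: c smult_assoc1[symmetric] R.m_ac)
  then have "(\<Oplus>\<^bsub>M\<^esub>p\<in>factorizations G n. L n \<odot>\<^bsub>M\<^esub> (\<alpha> (fst p) \<odot>\<^bsub>M\<^esub> f (snd p))) =
    (\<Oplus>\<^bsub>M\<^esub>p\<in>factorizations G n. Phi_ring G R L \<alpha> (fst p) \<odot>\<^bsub>M\<^esub> Phi_module G M L f (snd p))"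
    by (intro M.finsum_cong')
      (auto simp: factorizations_iff Phi_ring_def Phi_module_def c Lmult)
  moreover have "L n \<odot>\<^bsub>M\<^esub> (\<Oplus>\<^bsub>M\<^esub>p\<in>factorizations G n. \<alpha> (fst p) \<odot>\<^bsub>M\<^esub> f (snd p)) =
    (\<Oplus>\<^bsub>M\<^esub>p\<in>factorizations G n. L n \<odot>\<^bsub>M\<^esub> (\<alpha> (fst p) \<odot>\<^bsub>M\<^esub> f (snd p)))"
    using n by (intro finsum_smult_ldistr) (auto simp: c factorizations_iff finite_factorizations)
  ultimately show "Phi_module G M L (\<alpha> \<odot>\<^bsub>arith_module G M\<^esub> f) n =
    (Phi_ring G R L \<alpha> \<odot>\<^bsub>arith_module G M\<^esub> Phi_module G M L f) n"
    using n by (simp add: Phi_module_def arith_smult_apply)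
qed

section \<open>The convolution algebra and its modules\<close>

lemma arith_conv_closed:
  assumes "\<alpha> \<in> carrier G \<rightarrow>\<^sub>E carrier R" "\<beta> \<in> carrier G \<rightarrow>\<^sub>E carrier R"
  shows "arith_conv G R \<alpha> \<beta> \<in> carrier G \<rightarrow>\<^sub>E carrier R"
  using arith.arith_smult_closed[OF arith_regular] assms by (simp add: arith_conv_eq_smult)

lemma arith_conv_assoc:
  assumes "\<alpha> \<in> carrier G \<rightarrow>\<^sub>E carrier R" "\<beta> \<in> carrier G \<rightarrow>\<^sub>E carrier R"
    "\<gamma> \<in> carrier G \<rightarrow>\<^sub>E carrier R"
  shows "arith_conv G R (arith_conv G R \<alpha> \<beta>) \<gamma> = arith_conv G R \<alpha> (arith_conv G R \<beta> \<gamma>)"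
  using arith.arith_smult_assoc[OF arith_regular, of \<alpha> \<beta> \<gamma>] assms
  by (simp add: arith_conv_eq_smult)

lemma arith_const_conv:
  assumes "r \<in> carrier R" "\<alpha> \<in> carrier G \<rightarrow>\<^sub>E carrier R"
  shows "arith_conv G R (arith_const G R r) \<alpha> = (\<lambda>n\<in>carrier G. r \<otimes>\<^bsub>R\<^esub> \<alpha> n)"
  using arith.arith_const_smult[OF arith_regular, of r \<alpha>] assms
  by (simp add: arith_conv_eq_smult)

lemma arith_conv_l_distr:
  assumes "\<alpha> \<in> carrier G \<rightarrow>\<^sub>E carrier R" "\<beta> \<in> carrier G \<rightarrow>\<^sub>E carrier R"
    "\<gamma> \<in> carrier G \<rightarrow>\<^sub>E carrier R"
  shows "arith_conv G R (\<lambda>n\<in>carrier G. \<alpha> n \<oplus>\<^bsub>R\<^esub> \<beta> n) \<gamma> =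
    (\<lambda>n\<in>carrier G. arith_conv G R \<alpha> \<gamma> n \<oplus>\<^bsub>R\<^esub> arith_conv G R \<beta> \<gamma> n)"
  using arith.arith_smult_l_distr[OF arith_regular, of \<alpha> \<beta> \<gamma>] assms
  by (simp add: arith_conv_eq_smult)

lemma arith_conv_comm:
  assumes "\<alpha> \<in> carrier G \<rightarrow>\<^sub>E carrier R" "\<beta> \<in> carrier G \<rightarrow>\<^sub>E carrier R"
  shows "arith_conv G R \<alpha> \<beta> = arith_conv G R \<beta> \<alpha>"
  unfolding arith_conv_def
proof (rule restrict_ext)
  fix n assume "n \<in> carrier G"
  have c: "\<alpha> a \<in> carrier R" "\<beta> a \<in> carrier R" if "a \<in> carrier G" for a
    using assms that by auto
  have swap: "prod.swap ` factorizations G n = factorizations G n"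
    by (force simp: factorizations_def Gamma.m_comm)
  let ?g = "\<lambda>(a, b). \<beta> a \<otimes>\<^bsub>R\<^esub> \<alpha> b"
  have "finsum R (\<lambda>(a, b). \<alpha> a \<otimes>\<^bsub>R\<^esub> \<beta> b) (factorizations G n) =
    finsum R (\<lambda>p. ?g (prod.swap p)) (factorizations G n)"
    by (intro R.finsum_cong') (auto simp: factorizations_def c R.m_comm)
  also have "\<dots> = finsum R ?g (prod.swap ` factorizations G n)"
    by (intro R.finsum_reindex[symmetric]) (auto simp: factorizations_def c)
  finally show "finsum R (\<lambda>(a, b). \<alpha> a \<otimes>\<^bsub>R\<^esub> \<beta> b) (factorizations G n) =
    finsum R ?g (factorizations G n)"
    by (simp add: swap)
qed

lemma arith_const_closed: "r \<in> carrier R \<Longrightarrow> arith_const G R r \<in> carrier G \<rightarrow>\<^sub>E carrier R"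
  by (auto simp: arith_const_def)

lemma cring_arith_ring: "cring (arith_ring G R)"
proof (rule cringI)
  show "abelian_group (arith_ring G R)"
    by (rule abelian_group_PiE[OF R.is_abelian_group]) simp_all
  show "comm_monoid (arith_ring G R)"
  proof (rule comm_monoidI)
    fix \<alpha> assume \<alpha>: "\<alpha> \<in> carrier (arith_ring G R)"
    then show "\<one>\<^bsub>arith_ring G R\<^esub> \<otimes>\<^bsub>arith_ring G R\<^esub> \<alpha> = \<alpha>"
      by (intro extensionalityI[of _ "carrier G"])
        (auto simp: arith_const_conv PiE_iff)
  qed (auto simp: arith_conv_closed arith_conv_assoc arith_const_closed
      intro: arith_conv_comm)
qed (simp add: arith_conv_l_distr)

lemma algebra_arith_ring: "algebra R (arith_ring G R)"
proof (rule algebraI)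
  fix \<alpha> assume "\<alpha> \<in> carrier (arith_ring G R)"
  then show "\<one>\<^bsub>R\<^esub> \<odot>\<^bsub>arith_ring G R\<^esub> \<alpha> = \<alpha>"
    by (intro extensionalityI[of _ "carrier G"]) (auto simp: arith_const_conv PiE_iff)
next
  fix r \<alpha> \<beta>
  assume "r \<in> carrier R" "\<alpha> \<in> carrier (arith_ring G R)" "\<beta> \<in> carrier (arith_ring G R)"
  then show "(r \<odot>\<^bsub>arith_ring G R\<^esub> \<alpha>) \<otimes>\<^bsub>arith_ring G R\<^esub> \<beta> =
      r \<odot>\<^bsub>arith_ring G R\<^esub> (\<alpha> \<otimes>\<^bsub>arith_ring G R\<^esub> \<beta>)"
    by (simp add: arith_conv_assoc arith_const_closed)
qed (auto simp: arith_const_conv R.l_distr R.r_distr R.m_assoc PiE_iff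
    intro: R.is_cring cring_arith_ring intro!: restrict_ext)

lemma module_arith_module: "module (arith_ring G R) (arith_module G M)"
proof (rule moduleI)
  show "abelian_group (arith_module G M)"
    by (rule abelian_group_PiE[OF M.abelian_group_axioms]) simp_all
  fix f assume "f \<in> carrier (arith_module G M)"
  then show "\<one>\<^bsub>arith_ring G R\<^esub> \<odot>\<^bsub>arith_module G M\<^esub> f = f"
    by (intro extensionalityI[OF arith_smult_extensional])
      (auto simp: arith_const_smult PiE_iff)
qed (simp_all add: cring_arith_ring arith_smult_closed arith_smult_l_distr
    arith_smult_r_distr arith_smult_assoc)

section \<open>Twisting by a totally multiplicative function\<close>

lemma algebra_morphism_Phi_ring:
  assumes L: "L \<in> totally_multiplicative G R"
  shows "algebra_morphism R (arith_ring G R) (arith_ring G R) (Phi_ring G R L)"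
proof -
  have c: "L a \<in> carrier R" if "a \<in> carrier G" for a
    using L that by (auto simp: totally_multiplicative_def)
  have one: "L \<one>\<^bsub>G\<^esub> = \<one>\<^bsub>R\<^esub>"
    using L by (simp add: totally_multiplicative_def)
  have eq: "Phi_module G (regular_module R) L = Phi_ring G R L"
    by (simp add: Phi_module_def Phi_ring_def fun_eq_iff)
  have "Phi_ring G R L \<in> ring_hom (arith_ring G R) (arith_ring G R)"
  proof (rule ring_hom_memI)
    fix \<alpha> \<beta> assume "\<alpha> \<in> carrier (arith_ring G R)" "\<beta> \<in> carrier (arith_ring G R)"
    then show "Phi_ring G R L (\<alpha> \<otimes>\<^bsub>arith_ring G R\<^esub> \<beta>) =
        Phi_ring G R L \<alpha> \<otimes>\<^bsub>arith_ring G R\<^esub> Phi_ring G R L \<beta>"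
      using arith.Phi_module_smult[OF arith_regular L, of \<alpha> \<beta>]
      by (simp add: arith_conv_eq_smult eq)
  qed (auto simp: Phi_ring_def arith_const_def c one R.r_distr PiE_iff intro!: restrict_ext)
  moreover have "Phi_ring G R L (r \<odot>\<^bsub>arith_ring G R\<^esub> \<alpha>) =
      r \<odot>\<^bsub>arith_ring G R\<^esub> Phi_ring G R L \<alpha>"
    if "r \<in> carrier R" "\<alpha> \<in> carrier (arith_ring G R)" for r \<alpha>
  proof -
    have "Phi_ring G R L \<alpha> \<in> carrier G \<rightarrow>\<^sub>E carrier R"
      using that by (auto simp: Phi_ring_def c)
    then show ?thesis
      using that
      by (auto simp: arith_const_conv Phi_ring_def c R.m_lcomm PiE_iff intro!: restrict_ext)
  qed
  ultimately show ?thesis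
    using algebra_arith_ring by (simp add: algebra_morphism_def)
qed

lemma module_twisted:
  assumes L: "L \<in> totally_multiplicative G R"
  shows "module (arith_ring G R) (twisted_arith_module G R M L)"
  using restriction_of_scalars[OF cring_arith_ring module_arith_module]
    algebra_morphism_Phi_ring[OF L]
  by (simp add: algebra_morphism_def twisted_arith_module_def)

lemma module_morphism_Phi_module:
  assumes L: "L \<in> totally_multiplicative G R"
  shows "module_morphism (arith_ring G R) (arith_module G M) (twisted_arith_module G R M L)
    (Phi_module G M L)"
proof -
  have c: "L a \<in> carrier R" if "a \<in> carrier G" for a
    using L that by (auto simp: totally_multiplicative_def)
  show ?thesis
    using module_arith_module module_twisted[OF L] Phi_module_smult[OF L]
    by (auto simp: module_morphism_def twisted_arith_module_def Phi_module_def c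
        PiE_iff smult_r_distr intro!: restrict_ext)
qed

end

theorem proposition1p6:
  fixes R :: "('r, 'y) ring_scheme"
    and G :: "('g, 'x) monoid_scheme"
    and M :: "('r, 'm, 'z) module_scheme"
    and L :: "'g \<Rightarrow> 'r"
  assumes "cring R"
    and "comm_monoid G"
    and "finite_type G"
    and "module R M"
    and "L \<in> totally_multiplicative G R"
  shows "algebra_morphism R (arith_ring G R) (arith_ring G R) (Phi_ring G R L)
    \<and> module (arith_ring G R) (twisted_arith_module G R M L)
    \<and> module_morphism (arith_ring G R) (arith_module G M) (twisted_arith_module G R M L)
          (Phi_module G M L)"
proof -
  interpret arith R M G
    using assms by (simp add: arith_def arith_axioms_def)
  show ?thesis
    using algebra_morphism_Phi_ring module_twisted module_morphism_Phi_module assms(5) by blast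
qed

end
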